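(* Let $g$ be a Gårding-Dirichlet polynomial of degree $N\ge1$ on $S(n)$ with Gårding cone $\Gamma$, edge $E$, span $S=E^\perp$ and open polar $\Gamma^*$. For each $B\in\Gamma^*$, the function $$\psi(A)=\langle B,A\rangle-\log g(A),\qquad A\in\Gamma\cap S,$$ is an exhaustion function for $\Gamma\cap S$; that is, the prelevel sets $$K_c=\{A\in\Gamma\cap S:\psi(A)\le c\},\qquad c\in\mathbb{R},$$ are compact and $\bigcup_cK_c=\Gamma\cap S$. Moreover, $\psi$ is $C^\infty$ and strictly convex on $\Gamma\cap S$.
   Context: $S(n)$ is the space of real symmetric $n\times n$ matrices with inner product $\langle A,B\rangle=\mathrm{tr}(AB)$, used to identify $S(n)^*$ with $S(n)$, and $\mathcal P=\{A\in S(n):A\ge0\}$. A Gårding-Dirichlet polynomial (operator) of degree $N$ is a homogeneous real polynomial $g$ of degree $N$ on $S(n)$ such that $g(I)>0$, $t\mapsto g(tI+A)$ has all real roots for every $A\in S(n)$, and the Gårding cone $\Gamma$, i.e. the connected component of $\{g\ne0\}$ containing $I$ (an open convex cone), satisfies $\mathcal P\subset\overline\Gamma$. The edge is the linear subspace $E=\overline\Gamma\cap(-\overline\Gamma)$. The polar is $\Gamma^0=\{B\in S(n):\langle B,A\rangle\ge0\ \forall A\in\Gamma\}$, whose linear span is $S=E^\perp$, and the open polar $\Gamma^*$ is the interior of $\Gamma^0$ relative to $S$. *)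

theory Defs
  imports "HOL-Analysis.Analysis" "HOL-Computational_Algebra.Polynomial"
begin

definition sym_mats :: "(real^'n^'n) set" where
  "sym_mats = {A. transpose A = A}"

definition psd_mats :: "(real^'n^'n) set" where
  "psd_mats = {A \<in> sym_mats. \<forall>x. 0 \<le> x \<bullet> (A *v x)}"

definition trace_inner :: "real^'n^'n \<Rightarrow> real^'n^'n \<Rightarrow> real" where
  "trace_inner A B = trace (A ** B)"

text \<open>Polynomials on the space of symmetric matrices are represented by functions on all square
  matrices; only their values on symmetric matrices matter. Every polynomial on a subspace is the
  restriction of a polynomial on the whole space.\<close>

definition homogeneous_polynomial_on_sym :: "nat \<Rightarrow> (real^'n^'n \<Rightarrow> real) \<Rightarrow> bool" where
  "homogeneous_polynomial_on_sym N g \<longleftrightarrow>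
     (\<exists>p. real_polynomial_function p \<and> (\<forall>A\<in>sym_mats. g A = p A)) \<and>
     (\<forall>A\<in>sym_mats. \<forall>t. g (t *\<^sub>R A) = t ^ N * g A)"

definition garding_cone :: "(real^'n^'n \<Rightarrow> real) \<Rightarrow> (real^'n^'n) set" where
  "garding_cone g = connected_component_set {A \<in> sym_mats. g A \<noteq> 0} (mat 1)"

text \<open>``All roots real'' refers to the complex roots of the univariate real polynomial
  \<open>q\<close> whose polynomial function is \<open>t \<mapsto> g (t I + A)\<close>.\<close>

definition garding_dirichlet :: "nat \<Rightarrow> (real^'n^'n \<Rightarrow> real) \<Rightarrow> bool" where
  "garding_dirichlet N g \<longleftrightarrow>
     homogeneous_polynomial_on_sym N g \<and>
     g (mat 1) > 0 \<and>
     (\<forall>A\<in>sym_mats. \<exists>q :: real poly.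
        (\<forall>t. poly q t = g (t *\<^sub>R mat 1 + A)) \<and>
        (\<forall>z :: complex. poly (map_poly of_real q) z = 0 \<longrightarrow> z \<in> \<real>)) \<and>
     psd_mats \<subseteq> closure (garding_cone g)"

definition garding_edge :: "(real^'n^'n \<Rightarrow> real) \<Rightarrow> (real^'n^'n) set" where
  "garding_edge g = closure (garding_cone g) \<inter> uminus ` closure (garding_cone g)"

definition garding_span :: "(real^'n^'n \<Rightarrow> real) \<Rightarrow> (real^'n^'n) set" where
  "garding_span g = {B \<in> sym_mats. \<forall>A\<in>garding_edge g. trace_inner B A = 0}"

definition garding_polar :: "(real^'n^'n \<Rightarrow> real) \<Rightarrow> (real^'n^'n) set" where
  "garding_polar g = {B \<in> sym_mats. \<forall>A\<in>garding_cone g. 0 \<le> trace_inner B A}"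

definition garding_open_polar :: "(real^'n^'n \<Rightarrow> real) \<Rightarrow> (real^'n^'n) set" where
  "garding_open_polar g = top_of_set (garding_span g) interior_of garding_polar g"

definition exhaustion_function_on :: "'a::topological_space set \<Rightarrow> ('a \<Rightarrow> real) \<Rightarrow> bool" where
  "exhaustion_function_on X f \<longleftrightarrow>
     (\<forall>c. compact {x \<in> X. f x \<le> c}) \<and> (\<Union>c. {x \<in> X. f x \<le> c}) = X"

text \<open>\<open>Ck_on k V U f\<close>: \<open>f\<close> is of class $C^k$ on \<open>U\<close>, a relatively open subset of the linear
  subspace \<open>V\<close>. The values of the derivative \<open>f' x\<close> are determined on \<open>V\<close> only, and only
  those are used, so the recursion runs over the directional derivatives along \<open>V\<close>.\<close>

primrec Ck_on :: "nat \<Rightarrow> 'a::real_normed_vector set \<Rightarrow> 'a set \<Rightarrow> ('a \<Rightarrow> real) \<Rightarrow> bool" where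
  "Ck_on 0 V U f \<longleftrightarrow> continuous_on U f"
| "Ck_on (Suc k) V U f \<longleftrightarrow>
     (\<exists>f'. (\<forall>x\<in>U. (f has_derivative f' x) (at x within V)) \<and>
           (\<forall>v\<in>V. Ck_on k V U (\<lambda>x. f' x v)))"

definition C_infinity_on :: "'a::real_normed_vector set \<Rightarrow> 'a set \<Rightarrow> ('a \<Rightarrow> real) \<Rightarrow> bool" where
  "C_infinity_on V U f \<longleftrightarrow> (\<forall>k. Ck_on k V U f)"

definition strictly_convex_on :: "'a::real_vector set \<Rightarrow> ('a \<Rightarrow> real) \<Rightarrow> bool" where
  "strictly_convex_on U f \<longleftrightarrow> convex U \<and>
     (\<forall>x\<in>U. \<forall>y\<in>U. \<forall>t. x \<noteq> y \<and> 0 < t \<and> t < 1 \<longrightarrow>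
        f ((1 - t) *\<^sub>R x + t *\<^sub>R y) < (1 - t) * f x + t * f y)"

end

theory Submission
  imports Defs "HOL-Computational_Algebra.Fundamental_Theorem_Algebra"
begin

text \<open>
  The proof rests on Garding's theory of hyperbolic polynomials, developed here for a form \<open>p\<close>
  on a subspace \<open>L\<close> of a Euclidean space. A direction \<open>e\<close> with \<open>p e \<noteq> 0\<close> is hyperbolic if
  all complex roots \<open>\<zeta>\<close> of \<open>p (x + \<zeta> e)\<close> are real, for every \<open>x\<close> in \<open>L\<close>. A continuity argument for
  roots (\<open>roots_cannot_enter\<close>) shows that every point of the connected component of
  \<open>p \<noteq> 0\<close> containing \<open>e\<close> is again a hyperbolic direction (\<open>hyperbolic_cone\<close>), and that
  the segments between two such points avoid the zeros of \<open>p\<close>. Hence the component is a convex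
  cone.

  Hyperbolicity at a point \<open>x\<close> of the cone gives the factorization
  \<open>p (x + t D) = p x * (\<Prod>r. 1 - t r)\<close> with real \<open>r\<close> (\<open>line_factorization\<close>). Therefore
  \<open>- ln p\<close> is convex along every segment of the cone. It is strictly convex unless all the
  numbers \<open>r\<close> are \<open>0\<close>; then \<open>p\<close> is constant on the line through \<open>x\<close> in direction
  \<open>D\<close>, the line lies in the cone, and \<open>D\<close> belongs to the edge. Since the span is orthogonal
  to the edge, this cannot happen for a nonzero \<open>D\<close> in the span.

  A point \<open>B\<close> of the open polar satisfies \<open>\<epsilon> |A| \<le> \<langle>B, A\<rangle>\<close> on the part of the cone in the
  span (\<open>open_polar_coercive\<close>). Linear growth beats the logarithmic growth of \<open>ln (g A)\<close>, so
  sublevel sets are bounded. They are closed because \<open>g\<close> is bounded below by a positive constant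
  on each of them, while a boundary point of the component is a zero of \<open>g\<close>. Smoothness is
  elementary: the directional derivatives of \<open>ln g\<close> are quotients of polynomials with a power
  of \<open>g\<close> as denominator.
\<close>

section \<open>Roots of complex polynomials under deformation\<close>

text \<open>A quantitative form of the continuity of roots: in the factorization of \<open>P\<close> every
  factor \<open>z - r\<close> has norm at least \<open>\<delta>\<close>. Read contrapositively, a small value at \<open>z\<close>
  forces a root near \<open>z\<close>, with a bound that depends on the degree and the leading
  coefficient only.\<close>
lemma norm_poly_ge_root_distance:
  fixes P :: "complex poly"
  assumes "0 \<le> \<delta>" and far: "\<And>r. poly P r = 0 \<Longrightarrow> \<delta> \<le> norm (z - r)"
  shows "norm (lead_coeff P) * \<delta> ^ degree P \<le> norm (poly P z)"
proof (cases "P = 0")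
  case False
  then obtain A where A: "size A = degree P"
    "P = smult (lead_coeff P) (\<Prod>x\<in>#A. [:-x, 1:])"
    using alg_closed_imp_factorization by blast
  have eval: "poly (\<Prod>x\<in>#B. [:-x, 1:]) w = (\<Prod>x\<in>#B. w - x)" for B and w :: complex
    by (induction B) (auto simp: algebra_simps)
  have "poly P r = 0" if "r \<in># A" for r
  proof -
    have "poly P r = lead_coeff P * (\<Prod>x\<in>#A. r - x)"
      by (subst A(2)) (simp add: eval)
    with that show ?thesis by (auto simp: prod_mset_zero_iff)
  qed
  then have "\<And>r. r \<in># A \<Longrightarrow> \<delta> \<le> norm (z - r)" using far by blast
  then have "\<delta> ^ size A \<le> norm (\<Prod>x\<in>#A. z - x)"
  proof (induction A)
    case (add x A)
    have "\<delta> * \<delta> ^ size A \<le> norm (z - x) * norm (\<Prod>x\<in>#A. z - x)"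
      by (rule mult_mono) (use add assms(1) in auto)
    then show ?case by (simp add: norm_mult)
  qed auto
  then have "norm (lead_coeff P) * \<delta> ^ degree P \<le> norm (lead_coeff P * (\<Prod>x\<in>#A. z - x))"
    by (simp add: A(1) norm_mult mult_left_mono)
  also have "lead_coeff P * (\<Prod>x\<in>#A. z - x) = poly P z"
    by (subst (2) A(2)) (simp add: eval)
  finally show ?thesis .
qed auto

text \<open>Keeps the roots of a convergent family with fixed leading coefficient in a compact set.\<close>
lemma norm_root_le:
  fixes P :: "complex poly"
  assumes root: "poly P z = 0" and "P \<noteq> 0"
  shows "norm z \<le> 1 + (\<Sum>i<degree P. norm (coeff P i)) / norm (lead_coeff P)"
proof (cases "norm z \<le> 1")
  case True
  then show ?thesis by (smt (verit) divide_nonneg_nonneg norm_ge_zero sum_nonneg)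
next
  case False
  define n where "n = degree P"
  define S where "S = (\<Sum>i<n. norm (coeff P i))"
  have "n \<noteq> 0"
    using root \<open>P \<noteq> 0\<close> unfolding n_def by (metis degree_eq_zeroE mult_zero_right pCons_0_0 poly_pCons add.right_neutral poly_0)
  then obtain m where m: "n = Suc m" by (cases n) auto
  have "0 = (\<Sum>i\<le>n. coeff P i * z ^ i)" using root by (simp add: poly_altdef n_def)
  also have "\<dots> = (\<Sum>i<n. coeff P i * z ^ i) + coeff P n * z ^ n"
    by (simp add: lessThan_Suc_atMost[symmetric])
  finally have "coeff P n * z ^ n = - (\<Sum>i<n. coeff P i * z ^ i)" by (simp add: add_eq_0_iff)
  then have "norm (coeff P n) * norm z ^ n = norm (\<Sum>i<n. coeff P i * z ^ i)"
    by (metis norm_minus_cancel norm_mult norm_power)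
  also have "\<dots> \<le> (\<Sum>i<n. norm (coeff P i) * norm z ^ m)"
    using False m by (intro sum_norm_le) (auto simp: norm_mult norm_power intro!: mult_left_mono power_increasing)
  also have "\<dots> = S * norm z ^ m" by (simp add: S_def sum_distrib_right)
  finally have "norm z ^ m * (norm (coeff P n) * norm z) \<le> norm z ^ m * S"
    by (simp add: m mult_ac)
  then have "norm (coeff P n) * norm z \<le> S"
    using False by (metis mult_le_cancel_left_pos not_le zero_less_power zero_less_one less_trans)
  moreover have "norm (coeff P n) > 0" using \<open>P \<noteq> 0\<close> by (simp add: n_def)
  ultimately have "norm z \<le> S / norm (coeff P n)" by (simp add: field_simps)
  then show ?thesis by (simp add: S_def n_def)
qed

text \<open>While the parameter moves in a connected set, the roots move continuously and cannot escape
  to infinity, because degree and leading coefficient are fixed. Hence the set of parameters for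
  which there is a root in \<open>H\<close> is closed; and it is open as soon as roots in \<open>H\<close> are
  forced to lie in the open part \<open>U\<close>, that is, as soon as no root can sit on the boundary.
  This one principle, used for a right and for an upper half-plane, replaces all root
  tracking below.\<close>
lemma roots_cannot_enter:
  fixes F :: "'a::metric_space \<Rightarrow> complex poly"
  assumes "connected K" "closed H" "open U" "U \<subseteq> H"
    and deg: "\<And>s. s \<in> K \<Longrightarrow> degree (F s) = N"
    and lc: "\<And>s. s \<in> K \<Longrightarrow> coeff (F s) N = c" and "c \<noteq> 0"
    and cont: "\<And>i. continuous_on K (\<lambda>s. coeff (F s) i)"
    and forced: "\<And>s z. s \<in> K \<Longrightarrow> z \<in> H \<Longrightarrow> poly (F s) z = 0 \<Longrightarrow> z \<in> U"
    and "s0 \<in> K" and start: "\<And>z. z \<in> H \<Longrightarrow> poly (F s0) z \<noteq> 0"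
    and "s \<in> K" "z \<in> H"
  shows "poly (F s) z \<noteq> 0"
proof -
  define T where "T = {s\<in>K. \<exists>z\<in>H. poly (F s) z = 0}"
  have F_eval: "poly (F s) z = (\<Sum>i\<le>N. coeff (F s) i * z ^ i)" if "s \<in> K" for s z
    using deg[OF that] by (simp add: poly_altdef)
  have "openin (top_of_set K) T"
  proof (subst openin_subopen, intro ballI)
    fix s assume "s \<in> T"
    then obtain z where s: "s \<in> K" and z: "poly (F s) z = 0" "z \<in> U"
      using forced unfolding T_def by blast
    obtain \<delta> where \<delta>: "\<delta> > 0" "ball z \<delta> \<subseteq> U" using \<open>open U\<close> z openE by blast
    define W where "W = K \<inter> (\<lambda>s. norm (\<Sum>i\<le>N. coeff (F s) i * z ^ i)) -` {..<norm c * \<delta> ^ N}"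
    have "openin (top_of_set K) W"
      unfolding W_def by (intro continuous_openin_preimage_gen continuous_intros cont)
    moreover have "s \<in> W"
      using z s \<delta> \<open>c \<noteq> 0\<close> by (simp add: W_def F_eval[symmetric])
    moreover have "W \<subseteq> T"
    proof
      fix s' assume s': "s' \<in> W"
      then have K: "s' \<in> K" and small: "norm (poly (F s') z) < norm c * \<delta> ^ N"
        by (auto simp: W_def F_eval)
      then obtain r where "poly (F s') r = 0" "norm (z - r) < \<delta>"
        using norm_poly_ge_root_distance[of \<delta> "F s'" z] \<delta> deg[OF K] lc[OF K]
        by (metis less_eq_real_def linorder_not_le)
      then show "s' \<in> T" using \<delta> K \<open>U \<subseteq> H\<close> by (auto simp: T_def dist_norm subset_eq)
    qed
    ultimately show "\<exists>W. openin (top_of_set K) W \<and> s \<in> W \<and> W \<subseteq> T" by blast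
  qed
  moreover have "closedin (top_of_set K) T"
  proof -
    have "l \<in> T" if x: "\<And>n. x n \<in> T" and lim: "x \<longlonglongrightarrow> l" and l: "l \<in> K" for x l
    proof -
      have xK: "x n \<in> K" for n using x by (auto simp: T_def)
      have "\<forall>n. \<exists>z. z \<in> H \<and> poly (F (x n)) z = 0" using x by (auto simp: T_def)
      then obtain w where w: "\<And>n. w n \<in> H" "\<And>n. poly (F (x n)) (w n) = 0" by metis
      have coeff_lim: "(\<lambda>n. coeff (F (x n)) i) \<longlonglongrightarrow> coeff (F l) i" for i
        using continuous_on_tendsto_compose[OF cont lim l] xK by simp
      have "(\<lambda>n. 1 + (\<Sum>i<N. norm (coeff (F (x n)) i)) / norm c) \<longlonglongrightarrow>
              1 + (\<Sum>i<N. norm (coeff (F l) i)) / norm c"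
        using \<open>c \<noteq> 0\<close> by (intro tendsto_intros coeff_lim) auto
      then have "Bseq (\<lambda>n. 1 + (\<Sum>i<N. norm (coeff (F (x n)) i)) / norm c)"
        by (intro convergent_imp_Bseq convergentI)
      then obtain M where M: "\<And>n. norm (1 + (\<Sum>i<N. norm (coeff (F (x n)) i)) / norm c) \<le> M"
        by (auto simp: Bseq_def)
      have "norm (w n) \<le> M" for n
      proof -
        have "F (x n) \<noteq> 0" using lc[OF xK] \<open>c \<noteq> 0\<close> by (metis coeff_0)
        then have "norm (w n) \<le> 1 + (\<Sum>i<N. norm (coeff (F (x n)) i)) / norm c"
          using norm_root_le[OF w(2)] deg[OF xK] lc[OF xK] by metis
        then show ?thesis using M[of n] by (simp add: abs_le_iff)
      qed
      then have "bounded (range w)" by (auto simp: bounded_iff)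
      then obtain z \<rho> where \<rho>: "strict_mono \<rho>" "(w \<circ> \<rho>) \<longlonglongrightarrow> z"
        using bounded_imp_convergent_subsequence by blast
      have "z \<in> H"
        using \<open>closed H\<close> \<rho>(2) w(1) unfolding closed_sequential_limits by (metis comp_apply)
      have "(\<lambda>n. \<Sum>i\<le>N. coeff (F (x (\<rho> n))) i * (w \<circ> \<rho>) n ^ i) \<longlonglongrightarrow> (\<Sum>i\<le>N. coeff (F l) i * z ^ i)"
        using LIMSEQ_subseq_LIMSEQ[OF coeff_lim \<rho>(1)] \<rho>(2)
        by (intro tendsto_intros) (auto simp: o_def)
      then have "(\<lambda>n. 0) \<longlonglongrightarrow> poly (F l) z"
        using w(2) by (simp add: F_eval[OF xK, symmetric] F_eval[OF l, symmetric])
      then have "poly (F l) z = 0" by (simp add: LIMSEQ_const_iff)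
      then show ?thesis using l \<open>z \<in> H\<close> by (auto simp: T_def)
    qed
    then have "closure T \<inter> K \<subseteq> T" using closure_sequential[of _ T] by (metis IntE subsetI)
    moreover have "T \<subseteq> K" by (auto simp: T_def)
    moreover note closure_subset[of T]
    ultimately have "T = K \<inter> closure T" by blast
    then show ?thesis unfolding closedin_closed by blast
  qed
  ultimately have "T = {} \<or> T = K"
    using \<open>connected K\<close> unfolding connected_clopen by blast
  moreover have "s0 \<notin> T" using start by (auto simp: T_def)
  ultimately show ?thesis using \<open>s0 \<in> K\<close> \<open>s \<in> K\<close> \<open>z \<in> H\<close> by (auto simp: T_def)
qed

text \<open>\<open>R\<close> is \<open>q\<close> read in the coordinate \<open>1 / w\<close> at infinity, so \<open>R\<close> not vanishing at
  \<open>0\<close> means that the coefficient of degree \<open>N\<close> of \<open>q\<close> survives.\<close>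
lemma degree_lead_coeff_inversion:
  fixes q R :: "'a::{field_char_0} poly"
  assumes rel: "\<And>w. w \<noteq> 0 \<Longrightarrow> poly q w = w ^ N * poly R (inverse w)"
    and "poly R 0 \<noteq> 0"
  shows "degree q = N" "lead_coeff q = poly R 0"
proof -
  have R0: "coeff R 0 \<noteq> 0" using assms(2) by (simp add: poly_0_coeff_0)
  \<comment> \<open>Clearing the powers of \<open>1 / w\<close> gives an identity of polynomials off \<open>0\<close>, hence everywhere.\<close>
  have "poly (monom 1 (degree R) * q) w = poly (monom 1 N * reflect_poly R) w" if "w \<in> UNIV - {0}" for w
    using that by (simp add: rel poly_reflect_poly_nz poly_monom mult_ac)
  then have "{w. poly (monom 1 (degree R) * q - monom 1 N * reflect_poly R) w = 0} \<supseteq> UNIV - {0}"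
    by auto
  moreover have "infinite (UNIV - {0::'a})" by (simp add: infinite_UNIV_char_0)
  ultimately have eq: "monom 1 (degree R) * q = monom 1 N * reflect_poly R"
    by (metis eq_iff_diff_eq_0 finite_subset poly_roots_finite)
  have R': "degree (reflect_poly R) = degree R" "lead_coeff (reflect_poly R) = coeff R 0"
    using R0 by (auto simp: coeff_reflect_poly)
  have nz: "q \<noteq> 0" "reflect_poly R \<noteq> 0"
    using eq R0 R' by (metis coeff_0 mult_eq_0_iff monom_eq_0_iff one_neq_zero, metis coeff_0 R'(2))
  have "degree R + degree q = N + degree R"
    using arg_cong[OF eq, of degree] nz R' by (simp add: degree_mult_eq monom_eq_0_iff degree_monom_eq)
  then show "degree q = N" by simp
  show "lead_coeff q = poly R 0"
    using arg_cong[OF eq, of lead_coeff] unfolding lead_coeff_mult R'(2)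
    by (simp add: degree_monom_eq poly_0_coeff_0)
qed

section \<open>Complexification of a real polynomial\<close>

lemma complex_poly_eqI_reals:
  fixes P Q :: "complex poly"
  assumes "\<And>t::real. poly P (of_real t) = poly Q (of_real t)"
  shows "P = Q"
proof -
  have "\<real> \<subseteq> {z. poly (P - Q) z = 0}" using assms by (auto elim!: Reals_cases)
  moreover have "infinite (\<real> :: complex set)"
    unfolding Reals_def using finite_imageD infinite_UNIV_char_0 inj_of_real by blast
  ultimately show ?thesis
    by (metis eq_iff_diff_eq_0 finite_subset poly_roots_finite)
qed

text \<open>A pair \<open>(x, y)\<close> stands for the complex vector \<open>x + i y\<close>.\<close>
definition cscale :: "complex \<Rightarrow> 'v::real_vector \<times> 'v \<Rightarrow> 'v \<times> 'v" where
  "cscale \<zeta> z = (Re \<zeta> *\<^sub>R fst z - Im \<zeta> *\<^sub>R snd z, Im \<zeta> *\<^sub>R fst z + Re \<zeta> *\<^sub>R snd z)"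

lemma cscale_simps:
  "cscale (a * b) z = cscale a (cscale b z)"
  "cscale a (z + w) = cscale a z + cscale a w"
  "cscale (of_real t) z = t *\<^sub>R z"
  "cscale (a + b) z = cscale a z + cscale b z"
  by (auto simp: cscale_def algebra_simps prod_eq_iff)

lemma cscale_0_1 [simp]: "cscale 1 z = z" "cscale 0 z = 0" "cscale \<zeta> 0 = 0"
  by (auto simp: cscale_def prod_eq_iff)

lemma cscale_mem: "subspace L \<Longrightarrow> z \<in> L \<times> L \<Longrightarrow> cscale \<zeta> z \<in> L \<times> L"
  by (auto simp: cscale_def subspace_add subspace_diff subspace_scale)

text \<open>Only the restrictions of the extension to complex lines matter below: they are univariate
  polynomials whose coefficients depend continuously on the base point. This says enough about
  \<open>f\<close> to determine it and avoids multivariate complex polynomials.\<close>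
definition complexification :: "('v::real_normed_vector \<Rightarrow> real) \<Rightarrow> ('v \<times> 'v \<Rightarrow> complex) \<Rightarrow> bool" where
  "complexification p f \<longleftrightarrow> (\<forall>x. f (x, 0) = of_real (p x)) \<and>
     (\<forall>a. \<exists>q. (\<forall>i. continuous_on UNIV (\<lambda>z. coeff (q z) i)) \<and>
               (\<forall>z \<zeta>. poly (q z) \<zeta> = f (z + cscale \<zeta> a)))"

lemma ex_complexification:
  assumes "real_polynomial_function p"
  shows "\<exists>f. complexification p f"
  using assms
proof induction
  case (linear l)
  then interpret bounded_linear l .
  define f where "f z = of_real (l (fst z)) + \<i> * of_real (l (snd z))" for z
  have f_lin: "f (z + cscale \<zeta> a) = f z + \<zeta> * f a" for z \<zeta> a
    by (simp add: f_def cscale_def complex_eq_iff add diff scale algebra_simps)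
  have "continuous_on UNIV f"
    unfolding f_def by (intro continuous_intros continuous_on)
  show ?case
    unfolding complexification_def
  proof (intro exI[of _ f] conjI allI)
    fix a
    have "continuous_on UNIV (\<lambda>z. coeff [:f z, f a:] i)" for i
      using \<open>continuous_on UNIV f\<close>
      by (cases i) (auto simp: coeff_pCons split: nat.split)
    then show "\<exists>q. (\<forall>i. continuous_on UNIV (\<lambda>z. coeff (q z) i)) \<and>
               (\<forall>z \<zeta>. poly (q z) \<zeta> = f (z + cscale \<zeta> a))"
      by (intro exI[of _ "\<lambda>z. [:f z, f a:]"]) (simp add: f_lin)
  qed (simp add: f_def zero)
next
  case (const c)
  have "continuous_on UNIV (\<lambda>z::'a \<times> 'a. coeff [:complex_of_real c:] i)" for i by simp
  then show ?case
    unfolding complexification_def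
    by (intro exI[of _ "\<lambda>_. of_real c"] conjI allI exI[of _ "\<lambda>_. [:of_real c:]"]) auto
next
  case (add p1 p2)
  then obtain f1 f2 where "complexification p1 f1" "complexification p2 f2" by blast
  note f = this[unfolded complexification_def]
  show ?case
    unfolding complexification_def
  proof (intro exI[of _ "\<lambda>z. f1 z + f2 z"] conjI allI)
    fix a
    obtain q1 q2 where "\<forall>i. continuous_on UNIV (\<lambda>z. coeff (q1 z) i)" "\<forall>z \<zeta>. poly (q1 z) \<zeta> = f1 (z + cscale \<zeta> a)"
      "\<forall>i. continuous_on UNIV (\<lambda>z. coeff (q2 z) i)" "\<forall>z \<zeta>. poly (q2 z) \<zeta> = f2 (z + cscale \<zeta> a)"
      using f by blast
    then show "\<exists>q. (\<forall>i. continuous_on UNIV (\<lambda>z. coeff (q z) i)) \<and>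
               (\<forall>z \<zeta>. poly (q z) \<zeta> = f1 (z + cscale \<zeta> a) + f2 (z + cscale \<zeta> a))"
      by (intro exI[of _ "\<lambda>z. q1 z + q2 z"]) (auto intro!: continuous_intros)
  qed (use f in auto)
next
  case (mult p1 p2)
  then obtain f1 f2 where "complexification p1 f1" "complexification p2 f2" by blast
  note f = this[unfolded complexification_def]
  show ?case
    unfolding complexification_def
  proof (intro exI[of _ "\<lambda>z. f1 z * f2 z"] conjI allI)
    fix a
    obtain q1 q2 where "\<forall>i. continuous_on UNIV (\<lambda>z. coeff (q1 z) i)" "\<forall>z \<zeta>. poly (q1 z) \<zeta> = f1 (z + cscale \<zeta> a)"
      "\<forall>i. continuous_on UNIV (\<lambda>z. coeff (q2 z) i)" "\<forall>z \<zeta>. poly (q2 z) \<zeta> = f2 (z + cscale \<zeta> a)"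
      using f by blast
    then show "\<exists>q. (\<forall>i. continuous_on UNIV (\<lambda>z. coeff (q z) i)) \<and>
               (\<forall>z \<zeta>. poly (q z) \<zeta> = f1 (z + cscale \<zeta> a) * f2 (z + cscale \<zeta> a))"
      by (intro exI[of _ "\<lambda>z. q1 z * q2 z"]) (auto simp: coeff_mult intro!: continuous_intros)
  qed (use f in auto)
qed

section \<open>Hyperbolic directions\<close>

text \<open>A form of degree \<open>N\<close> on a subspace \<open>L\<close>, together with its extension to the complex
  vectors. Homogeneity is required on \<open>L\<close> alone, since a polynomial representing a function
  on \<open>L\<close> is arbitrary off \<open>L\<close>.\<close>
locale complexified_form =
  fixes L :: "'v::euclidean_space set" and p :: "'v \<Rightarrow> real"
    and f :: "'v \<times> 'v \<Rightarrow> complex" and N :: nat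
  assumes L: "subspace L"
    and f: "complexification p f"
    and p_homogeneous: "\<And>x t. x \<in> L \<Longrightarrow> p (t *\<^sub>R x) = t ^ N * p x"
begin

lemma f_real: "f (x, 0) = of_real (p x)"
  using f by (simp add: complexification_def)

lemma ex_line_poly: "\<exists>q. \<forall>\<zeta>. poly q \<zeta> = f (z + cscale \<zeta> a)"
  using f unfolding complexification_def by meson

lemma continuous_p: "continuous_on UNIV p"
proof -
  obtain q where q: "\<forall>i. continuous_on UNIV (\<lambda>z. coeff (q z) i)" "\<forall>z \<zeta>. poly (q z) \<zeta> = f (z + cscale \<zeta> 0)"
    using f unfolding complexification_def by meson
  have "coeff (q z) 0 = f z" for z
    using q(2)[rule_format, of z 0] by (simp add: poly_0_coeff_0)
  then have "continuous_on UNIV f" using q(1)[rule_format, of 0] by simp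
  then have "continuous_on UNIV (\<lambda>x. f (x, 0))"
    by (rule continuous_on_compose2) (auto intro!: continuous_intros)
  then have "continuous_on UNIV (\<lambda>x. Re (f (x, 0)))" by (rule continuous_on_Re)
  then show ?thesis by (simp add: f_real)
qed

text \<open>Two univariate identity arguments: along the complex line through a real vector \<open>x\<close> the
  claim holds for real factors, hence for all; and with the factor fixed it then holds at
  \<open>x + w y\<close> for real \<open>w\<close>, hence at \<open>w = i\<close>.\<close>
lemma f_homogeneous:
  assumes "z \<in> L \<times> L"
  shows "f (cscale \<zeta> z) = \<zeta> ^ N * f z"
proof -
  have real_case: "f (cscale \<zeta> (x, 0)) = \<zeta> ^ N * f (x, 0)" if "x \<in> L" for x \<zeta>
  proof -
    obtain q where q: "\<And>\<zeta>. poly q \<zeta> = f (0 + cscale \<zeta> (x, 0))" using ex_line_poly by blast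
    have "q = monom (f (x, 0)) N"
      by (rule complex_poly_eqI_reals)
        (use that in \<open>simp add: q cscale_simps f_real p_homogeneous poly_monom\<close>)
    then show ?thesis using q[of \<zeta>] by (simp add: poly_monom mult.commute)
  qed
  obtain x y where z: "z = (x, y)" "x \<in> L" "y \<in> L" using assms by auto
  obtain q1 where q1: "\<And>w. poly q1 w = f (cscale \<zeta> (x, 0) + cscale w (cscale \<zeta> (y, 0)))"
    using ex_line_poly by blast
  obtain q2 where q2: "\<And>w. poly q2 w = f ((x, 0) + cscale w (y, 0))"
    using ex_line_poly by blast
  have "q1 = smult (\<zeta> ^ N) q2"
  proof (rule complex_poly_eqI_reals)
    fix t :: real
    have "cscale \<zeta> (x, 0) + cscale (of_real t) (cscale \<zeta> (y, 0)) = cscale \<zeta> (x + t *\<^sub>R y, 0)"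
      by (simp add: cscale_def algebra_simps)
    then show "poly q1 (of_real t) = poly (smult (\<zeta> ^ N) q2) (of_real t)"
      using z L by (simp add: q1 q2 cscale_simps(3) real_case subspace_add subspace_scale)
  qed
  moreover have "cscale \<zeta> z = cscale \<zeta> (x, 0) + cscale \<i> (cscale \<zeta> (y, 0))" "z = (x, 0) + cscale \<i> (y, 0)"
    by (simp_all add: z cscale_def)
  ultimately show ?thesis by (metis poly_smult q1 q2)
qed

text \<open>The restrictions of \<open>f\<close> to the complex lines in a real direction \<open>a\<close> form a family to
  which \<open>roots_cannot_enter\<close> applies: degree and leading coefficient do not depend on the
  base point.\<close>
lemma line_polys:
  assumes "a \<in> L" "p a \<noteq> 0"
  obtains q where "\<And>i. continuous_on UNIV (\<lambda>z. coeff (q z) i)"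
    and "\<And>z \<zeta>. poly (q z) \<zeta> = f (z + cscale \<zeta> (a, 0))"
    and "\<And>z. z \<in> L \<times> L \<Longrightarrow> degree (q z) = N"
    and "\<And>z. z \<in> L \<times> L \<Longrightarrow> coeff (q z) N = of_real (p a)"
proof -
  obtain q where q: "\<And>i. continuous_on UNIV (\<lambda>z. coeff (q z) i)"
    "\<And>z \<zeta>. poly (q z) \<zeta> = f (z + cscale \<zeta> (a, 0))"
    using f unfolding complexification_def by meson
  have "degree (q z) = N \<and> lead_coeff (q z) = of_real (p a)" if z: "z \<in> L \<times> L" for z
  proof -
    obtain R where R: "\<And>w. poly R w = f ((a, 0) + cscale w z)" using ex_line_poly by blast
    have R0: "poly R 0 = of_real (p a)" by (simp add: R f_real)
    have "poly (q z) w = w ^ N * poly R (inverse w)" if "w \<noteq> 0" for w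
    proof -
      have "z + cscale w (a, 0) = cscale w ((a, 0) + cscale (inverse w) z)"
        using that by (simp add: cscale_simps(2) cscale_simps(1)[symmetric])
      moreover have "(a, 0) + cscale (inverse w) z \<in> L \<times> L"
        using cscale_mem[OF L z, of "inverse w"] \<open>a \<in> L\<close> L by (auto simp: subspace_add)
      ultimately show ?thesis by (simp add: q(2) R f_homogeneous)
    qed
    then show ?thesis
      using degree_lead_coeff_inversion[of "q z" N R] R0 \<open>p a \<noteq> 0\<close> by (metis of_real_eq_0_iff)
  qed
  then show ?thesis using that q by metis
qed

definition hyperbolic :: "'v \<Rightarrow> bool" where
  "hyperbolic e \<longleftrightarrow> e \<in> L \<and> p e \<noteq> 0 \<and> (\<forall>x\<in>L. \<forall>\<zeta>. f ((x, 0) + cscale \<zeta> (e, 0)) = 0 \<longrightarrow> \<zeta> \<in> \<real>)"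

lemma hyperbolicI:
  assumes "e \<in> L" "p e \<noteq> 0"
    and "\<And>x. x \<in> L \<Longrightarrow> \<exists>q. (\<forall>t. poly q t = p (t *\<^sub>R e + x)) \<and>
        (\<forall>z :: complex. poly (map_poly of_real q) z = 0 \<longrightarrow> z \<in> \<real>)"
  shows "hyperbolic e"
  unfolding hyperbolic_def
proof (intro conjI ballI allI impI assms(1,2))
  fix x \<zeta> assume "x \<in> L" and root: "f ((x, 0) + cscale \<zeta> (e, 0)) = 0"
  then obtain q where q: "\<And>t. poly q t = p (t *\<^sub>R e + x)"
    "\<And>z :: complex. poly (map_poly of_real q) z = 0 \<Longrightarrow> z \<in> \<real>"
    using assms(3) by metis
  obtain Q where Q: "\<And>\<zeta>. poly Q \<zeta> = f ((x, 0) + cscale \<zeta> (e, 0))" using ex_line_poly by blast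
  have "poly (map_poly complex_of_real q) (of_real t) = of_real (poly q t)" for t
    by (induction q) (simp_all add: map_poly_pCons)
  then have "Q = map_poly of_real q"
    by (intro complex_poly_eqI_reals) (simp add: Q q(1) cscale_simps f_real add.commute)
  then show "\<zeta> \<in> \<real>" using Q root q(2) by metis
qed

text \<open>The roots of \<open>\<zeta> \<mapsto> p (a + \<zeta> e)\<close> are real, and \<open>0\<close> is not among them while \<open>p a\<close>
  does not vanish. So as \<open>a\<close> moves away from \<open>e\<close> within \<open>p \<noteq> 0\<close>, no root can cross the
  imaginary axis, and at \<open>a = e\<close> every root is \<open>-1\<close>.\<close>
lemma cone_ray_root_free:
  assumes "hyperbolic e" "connected K" "K \<subseteq> {x\<in>L. p x \<noteq> 0}" "e \<in> K" "a \<in> K" "0 \<le> Re \<zeta>"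
  shows "f ((a, 0) + cscale \<zeta> (e, 0)) \<noteq> 0"
proof -
  have e: "e \<in> L" "p e \<noteq> 0" using \<open>hyperbolic e\<close> by (auto simp: hyperbolic_def)
  obtain q where q: "\<And>i. continuous_on UNIV (\<lambda>z. coeff (q z) i)"
    "\<And>z \<zeta>. poly (q z) \<zeta> = f (z + cscale \<zeta> (e, 0))"
    "\<And>z. z \<in> L \<times> L \<Longrightarrow> degree (q z) = N"
    "\<And>z. z \<in> L \<times> L \<Longrightarrow> coeff (q z) N = of_real (p e)"
    using line_polys[OF e] by metis
  have KL: "x \<in> K \<Longrightarrow> (x, 0) \<in> L \<times> L" for x
    using assms(3) L by (auto simp: subspace_0)
  have "poly (q (a, 0)) \<zeta> \<noteq> 0"
  proof (rule roots_cannot_enter[where K = K and H = "{z. 0 \<le> Re z}" and U = "{z. 0 < Re z}"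
        and F = "\<lambda>x. q (x, 0)" and N = N and c = "of_real (p e)" and ?s0.0 = e])
    show "continuous_on K (\<lambda>s. coeff (q (s, 0)) i)" for i
      by (rule continuous_on_compose2[OF q(1)]) (auto intro!: continuous_intros)
    show "z \<in> {z. 0 < Re z}" if "x \<in> K" "z \<in> {z. 0 \<le> Re z}" "poly (q (x, 0)) z = 0" for x z
    proof -
      have "z \<in> \<real>" using that q(2) \<open>hyperbolic e\<close> KL unfolding hyperbolic_def by auto
      moreover have "z \<noteq> 0" using that assms(3) q(2) by (auto simp: f_real)
      ultimately show ?thesis using that(2) by (auto elim!: Reals_cases)
    qed
    show "poly (q (e, 0)) z \<noteq> 0" if "z \<in> {z. 0 \<le> Re z}" for z
    proof -
      have "(e, 0) + cscale z (e, 0) = cscale (1 + z) (e, 0)" by (simp add: cscale_simps)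
      moreover have "1 + z \<noteq> 0" using that by (auto simp: complex_eq_iff)
      ultimately show ?thesis using e KL[OF \<open>e \<in> K\<close>] by (simp add: q(2) f_homogeneous f_real)
    qed
  qed (use assms KL q e in \<open>auto simp: closed_halfspace_Re_ge open_halfspace_Re_gt\<close>)
  then show ?thesis by (simp add: q(2))
qed

text \<open>The central step of Garding's theory. For \<open>\<alpha> > 0\<close> consider the roots \<open>z\<close> of
  \<open>f (x + i \<alpha> e + z a)\<close>. None is real, since that would make \<open>i \<alpha>\<close> a root in the
  hyperbolic direction \<open>e\<close>. For \<open>x = 0\<close> and \<open>\<alpha> = 1\<close> they all lie in the lower half-plane
  by the assumption on the ray, so this holds for all \<open>x\<close> and all \<open>\<alpha> > 0\<close>. Letting
  \<open>\<alpha>\<close> tend to \<open>0\<close>, no root of \<open>f (x + z a)\<close> lies in the upper half-plane. Replacing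
  \<open>(x, z)\<close> by \<open>(-x, -z)\<close> excludes the lower half-plane too.\<close>
lemma hyperbolic_transfer:
  assumes "hyperbolic e" "a \<in> L" and ray: "\<And>t. 0 \<le> t \<Longrightarrow> p (a + t *\<^sub>R e) \<noteq> 0"
  shows "hyperbolic a"
proof -
  have e: "e \<in> L" "p e \<noteq> 0" and e_hyp: "\<And>x \<zeta>. x \<in> L \<Longrightarrow> f ((x, 0) + cscale \<zeta> (e, 0)) = 0 \<Longrightarrow> \<zeta> \<in> \<real>"
    using \<open>hyperbolic e\<close> by (auto simp: hyperbolic_def)
  have a: "a \<in> L" "p a \<noteq> 0" using assms(2) ray[of 0] by auto
  obtain q where q: "\<And>i. continuous_on UNIV (\<lambda>z. coeff (q z) i)"
    "\<And>z \<zeta>. poly (q z) \<zeta> = f (z + cscale \<zeta> (a, 0))"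
    "\<And>z. z \<in> L \<times> L \<Longrightarrow> degree (q z) = N"
    "\<And>z. z \<in> L \<times> L \<Longrightarrow> coeff (q z) N = of_real (p a)"
    using line_polys[OF a] by metis
  define H where "H = {z. 0 \<le> Im z}"
  define K where "K = L \<times> ((\<lambda>\<alpha>. \<alpha> *\<^sub>R e) ` {0<..})"
  have KL: "K \<subseteq> L \<times> L" using L e by (auto simp: K_def subspace_scale)
  \<comment> \<open>By homogeneity a root \<open>z\<close> of \<open>f (i e + z a)\<close> gives the root \<open>i / z\<close> of \<open>f (a + w e)\<close>.\<close>
  have start: "poly (q (0, e)) z \<noteq> 0" if "z \<in> H" for z
  proof
    assume root: "poly (q (0, e)) z = 0"
    have eL: "(e, 0) \<in> L \<times> L" using e L by (simp add: subspace_0)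
    have i_e: "(0, e) = cscale \<i> (e, 0)" by (simp add: cscale_def)
    have "z \<noteq> 0" using root eL e by (auto simp: q(2) i_e f_homogeneous f_real)
    have "(0, e) + cscale z (a, 0) = cscale z ((a, 0) + cscale (\<i> / z) (e, 0))"
      using \<open>z \<noteq> 0\<close> by (simp add: i_e cscale_simps(2) cscale_simps(1)[symmetric])
    moreover have "(a, 0) + cscale (\<i> / z) (e, 0) \<in> L \<times> L"
      using cscale_mem[OF L eL, of "\<i> / z"] a L by (auto simp: subspace_add)
    ultimately have root': "f ((a, 0) + cscale (\<i> / z) (e, 0)) = 0"
      using root \<open>z \<noteq> 0\<close> by (simp add: q(2) f_homogeneous)
    then obtain t where t: "\<i> / z = of_real t" using e_hyp[OF a(1)] by (auto elim!: Reals_cases)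
    have "t \<noteq> 0" using t \<open>z \<noteq> 0\<close> by auto
    have "\<i> = of_real t * z" using t \<open>z \<noteq> 0\<close> by (simp add: field_simps)
    then have "1 = t * Im z" by (simp add: complex_eq_iff)
    then have "0 \<le> t" using that by (smt (verit) H_def mem_Collect_eq mult_neg_pos mult_not_zero mult_nonpos_nonneg)
    moreover have "p (a + t *\<^sub>R e) = 0" using root' t by (simp add: cscale_simps f_real)
    ultimately show False using ray by blast
  qed
  have K_root_free: "poly (q s) z \<noteq> 0" if "s \<in> K" "z \<in> H" for s z
  proof (rule roots_cannot_enter[where K = K and H = H and U = "{z. 0 < Im z}"
        and F = q and N = N and c = "of_real (p a)" and ?s0.0 = "(0, e)"])
    have "convex ((\<lambda>\<alpha>. \<alpha> *\<^sub>R e) ` {0<..})"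
      by (intro convex_linear_image) (auto intro: linearI simp: algebra_simps)
    then show "connected K"
      unfolding K_def by (intro convex_connected convex_Times subspace_imp_convex[OF L])
    show "continuous_on K (\<lambda>s. coeff (q s) i)" for i
      using continuous_on_subset[OF q(1)] by blast
    show "z \<in> {z. 0 < Im z}" if s: "s \<in> K" and z: "z \<in> H" and root: "poly (q s) z = 0" for s z
    proof (rule ccontr)
      assume "z \<notin> {z. 0 < Im z}"
      then have "z = of_real (Re z)" using z by (auto simp: H_def complex_eq_iff)
      moreover obtain x \<alpha> where x: "s = (x, \<alpha> *\<^sub>R e)" "x \<in> L" "0 < \<alpha>" using s by (auto simp: K_def)
      moreover have "(x, \<alpha> *\<^sub>R e) + cscale (of_real t) (a, 0) = (x + t *\<^sub>R a, 0) + cscale (\<i> * of_real \<alpha>) (e, 0)" for t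
        by (simp add: cscale_def)
      ultimately have "f ((x + Re z *\<^sub>R a, 0) + cscale (\<i> * of_real \<alpha>) (e, 0)) = 0"
        using root q(2) by metis
      then have "\<i> * of_real \<alpha> \<in> \<real>" using x a L by (intro e_hyp) (auto simp: subspace_add subspace_scale)
      then show False using x(3) by (simp add: complex_is_Real_iff)
    qed
    show "(0, e) \<in> K" unfolding K_def using L by (auto simp: subspace_0 intro!: image_eqI[of _ _ 1])
  qed (use that KL q a start in \<open>auto simp: H_def closed_halfspace_Im_ge open_halfspace_Im_gt\<close>)
  \<comment> \<open>A root \<open>z\<close> in the upper half-plane at \<open>\<alpha> = 0\<close> has distance at least \<open>Im z\<close> from all roots for \<open>\<alpha> > 0\<close>, so the values at \<open>z\<close> cannot tend to \<open>0\<close>.\<close>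
  have upper: "f ((x, 0) + cscale z (a, 0)) \<noteq> 0" if "x \<in> L" "0 < Im z" for x z
  proof
    assume root: "f ((x, 0) + cscale z (a, 0)) = 0"
    define s where "s n = (x, inverse (real (Suc n)) *\<^sub>R e)" for n
    have sK: "s n \<in> K" for n using that by (auto simp: s_def K_def)
    have "s \<longlonglongrightarrow> (x, 0 *\<^sub>R e)"
      unfolding s_def by (intro tendsto_intros LIMSEQ_inverse_real_of_nat)
    then have "(\<lambda>n. \<Sum>i\<le>N. coeff (q (s n)) i * z ^ i) \<longlonglongrightarrow> (\<Sum>i\<le>N. coeff (q (x, 0)) i * z ^ i)"
      by (intro tendsto_intros continuous_on_tendsto_compose[OF q(1)]) auto
    moreover have "(\<Sum>i\<le>N. coeff (q s) i * z ^ i) = poly (q s) z" if "s \<in> L \<times> L" for s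
      using that by (simp add: poly_altdef q(3))
    ultimately have "(\<lambda>n. poly (q (s n)) z) \<longlonglongrightarrow> poly (q (x, 0)) z"
      using sK KL \<open>x \<in> L\<close> L by (simp add: subspace_0 subset_eq)
    then have lim: "(\<lambda>n. norm (poly (q (s n)) z)) \<longlonglongrightarrow> 0"
      using root by (metis q(2) tendsto_norm_zero)
    have "norm (p a) * Im z ^ N \<le> norm (poly (q (s n)) z)" for n
    proof -
      have "Im z \<le> norm (z - r)" if "poly (q (s n)) r = 0" for r
      proof -
        have "r \<notin> H" using K_root_free[OF sK] that by blast
        then have "Im r < 0" by (simp add: H_def)
        then show ?thesis using abs_Im_le_cmod[of "z - r"] by simp
      qed
      then show ?thesis
        using norm_poly_ge_root_distance[of "Im z" "q (s n)" z] \<open>0 < Im z\<close> q(3,4) sK KL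
        by (metis less_imp_le norm_of_real real_norm_def subsetD)
    qed
    then have "norm (p a) * Im z ^ N \<le> 0" by (intro LIMSEQ_le_const[OF lim]) auto
    moreover have "0 < Im z ^ N" using \<open>0 < Im z\<close> by simp
    ultimately show False using a by (simp add: mult_le_0_iff)
  qed
  show ?thesis
    unfolding hyperbolic_def
  proof (intro conjI a ballI allI impI)
    fix x z assume x: "x \<in> L" and root: "f ((x, 0) + cscale z (a, 0)) = 0"
    have aL: "(x, 0) + cscale z (a, 0) \<in> L \<times> L"
      using cscale_mem[OF L, of "(a, 0)" z] x a L by (auto simp: subspace_add subspace_0)
    have "(- x, 0) + cscale (- z) (a, 0) = cscale (-1) ((x, 0) + cscale z (a, 0))"
      by (simp add: cscale_def)
    then have "f ((- x, 0) + cscale (- z) (a, 0)) = 0" using root aL by (simp only: f_homogeneous) simp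
    then have "\<not> 0 < Im (- z)" using upper x L subspace_neg by blast
    moreover have "\<not> 0 < Im z" using upper x root by blast
    ultimately show "z \<in> \<real>" by (simp add: complex_is_Real_iff)
  qed
qed

end

section \<open>Logarithms of affine factors\<close>

text \<open>Strict concavity of \<open>t \<mapsto> ln (1 - t r)\<close> between \<open>0\<close> and \<open>t = 1\<close>. The proof adds the
  tangent bound \<open>ln u \<le> u - 1\<close> at the two end points, scaled by their weighted mean \<open>1 - t r\<close>.\<close>
lemma ln_affine_ge:
  fixes r t :: real
  assumes "r < 1" "0 < t" "t < 1"
  shows "t * ln (1 - r) \<le> ln (1 - t * r)"
    and "r \<noteq> 0 \<Longrightarrow> t * ln (1 - r) < ln (1 - t * r)"
proof -
  define m where "m = 1 - t * r"
  have "t * r < 1"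
    using assms by (smt (verit) mult_left_le_one_le mult_less_cancel_right2 mult_nonneg_nonpos)
  then have m: "m > 0" by (simp add: m_def)
  have 1: "ln (1 / m) \<le> 1 / m - 1" using m by (intro ln_le_minus_one) simp
  have 2: "ln ((1 - r) / m) \<le> (1 - r) / m - 1" using m assms by (intro ln_le_minus_one) simp
  have avg: "(1 - t) * (1 / m - 1) + t * ((1 - r) / m - 1) = 0"
    using m by (simp add: field_simps m_def)
  have expand: "(1 - t) * ln (1 / m) + t * ln ((1 - r) / m) = t * ln (1 - r) - ln m"
    using m assms by (simp add: ln_div algebra_simps)
  have t: "0 \<le> 1 - t" "0 \<le> t" "0 < 1 - t" using assms by auto
  show "t * ln (1 - r) \<le> ln (1 - t * r)"
    using add_mono[OF mult_left_mono[OF 1 t(1)] mult_left_mono[OF 2 t(2)]] avg expand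
    by (simp add: m_def)
  show "t * ln (1 - r) < ln (1 - t * r)" if "r \<noteq> 0"
  proof -
    have "1 / m \<noteq> 1" using that assms m by (simp add: m_def)
    then have "ln (1 / m) < 1 / m - 1"
      using 1 m ln_eq_minus_one[of "1 / m"] by fastforce
    then show ?thesis
      using add_less_le_mono[OF mult_strict_left_mono[OF _ t(3)] mult_left_mono[OF 2 t(2)]] avg expand
      by (fastforce simp: m_def)
  qed
qed

lemma ln_prod_affine_gt:
  fixes A :: "real multiset"
  assumes "\<And>r. r \<in># A \<Longrightarrow> r < 1" "0 < t" "t < 1"
  shows "0 < (\<Prod>r\<in>#A. 1 - r)" "0 < (\<Prod>r\<in>#A. 1 - t * r)"
    "(\<exists>r\<in>#A. r \<noteq> 0) \<Longrightarrow> t * ln (\<Prod>r\<in>#A. 1 - r) < ln (\<Prod>r\<in>#A. 1 - t * r)"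
proof -
  have "0 < (\<Prod>r\<in>#A. 1 - r) \<and> 0 < (\<Prod>r\<in>#A. 1 - t * r) \<and>
    t * ln (\<Prod>r\<in>#A. 1 - r) \<le> ln (\<Prod>r\<in>#A. 1 - t * r) \<and>
    ((\<exists>r\<in>#A. r \<noteq> 0) \<longrightarrow> t * ln (\<Prod>r\<in>#A. 1 - r) < ln (\<Prod>r\<in>#A. 1 - t * r))"
    using assms(1)
  proof (induction A)
    case (add r A)
    have r: "r < 1" using add.prems by simp
    have IH: "0 < (\<Prod>r\<in>#A. 1 - r)" "0 < (\<Prod>r\<in>#A. 1 - t * r)"
      "t * ln (\<Prod>r\<in>#A. 1 - r) \<le> ln (\<Prod>r\<in>#A. 1 - t * r)"
      "(\<exists>r\<in>#A. r \<noteq> 0) \<longrightarrow> t * ln (\<Prod>r\<in>#A. 1 - r) < ln (\<Prod>r\<in>#A. 1 - t * r)"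
      using add by auto
    have tr: "t * r < 1"
      using r assms by (smt (verit) mult_left_le_one_le mult_less_cancel_right2 mult_nonneg_nonpos)
    note one = ln_affine_ge[OF r assms(2,3)]
    have ln_eq:
      "ln (\<Prod>r\<in>#add_mset r A. 1 - r) = ln (1 - r) + ln (\<Prod>r\<in>#A. 1 - r)"
      "ln (\<Prod>r\<in>#add_mset r A. 1 - t * r) = ln (1 - t * r) + ln (\<Prod>r\<in>#A. 1 - t * r)"
      unfolding image_mset_add_mset prod_mset.add_mset
      by (rule ln_mult_pos; use IH r tr in simp)+
    show ?case
      unfolding ln_eq distrib_left
      using IH r tr one by (auto intro: add_mono add_le_less_mono add_less_le_mono)
  qed auto
  then show "0 < (\<Prod>r\<in>#A. 1 - r)" "0 < (\<Prod>r\<in>#A. 1 - t * r)"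
    "(\<exists>r\<in>#A. r \<noteq> 0) \<Longrightarrow> t * ln (\<Prod>r\<in>#A. 1 - r) < ln (\<Prod>r\<in>#A. 1 - t * r)"
    by blast+
qed

context complexified_form
begin

section \<open>The Garding cone\<close>

abbreviation hcone :: "'v \<Rightarrow> 'v set" where
  "hcone e \<equiv> connected_component_set {x \<in> L. p x \<noteq> 0} e"

lemma cone_nonzero: "x \<in> hcone e \<Longrightarrow> x \<in> L \<and> p x \<noteq> 0"
  using connected_component_subset by fastforce

lemma cone_contains_self: "hyperbolic e \<Longrightarrow> e \<in> hcone e"
  by (simp add: hyperbolic_def)

lemma cone_ray:
  assumes "hyperbolic e" "a \<in> hcone e" "0 \<le> t"
  shows "p (a + t *\<^sub>R e) \<noteq> 0"
proof -
  have "f ((a, 0) + cscale (of_real t) (e, 0)) \<noteq> 0"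
    using assms cone_contains_self connected_component_subset
    by (intro cone_ray_root_free[of e "hcone e"]) auto
  then show ?thesis by (simp add: cscale_simps f_real)
qed

text \<open>Hyperbolicity propagates over the whole component; this gives the symmetry between the points
  of the cone that convexity rests on.\<close>
lemma hyperbolic_cone: "hyperbolic e \<Longrightarrow> a \<in> hcone e \<Longrightarrow> hyperbolic a"
  using hyperbolic_transfer cone_ray cone_nonzero by blast

lemma cone_eq: "a \<in> hcone e \<Longrightarrow> hcone a = hcone e"
  using connected_component_eq by fastforce

text \<open>Every point \<open>a\<close> of the cone may serve as the base direction, and the ray \<open>b + t a\<close> then
  avoids the zeros of \<open>p\<close>. Up to scaling this ray is the segment from \<open>b\<close> to \<open>a\<close>, so the
  segment stays in the component.\<close>
lemma convex_cone:
  assumes "hyperbolic e"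
  shows "convex (hcone e)"
  unfolding convex_contains_segment
proof (intro ballI)
  fix a b assume a: "a \<in> hcone e" and b: "b \<in> hcone e"
  have "hyperbolic a" using hyperbolic_cone assms a by blast
  have ray: "p (b + t *\<^sub>R a) \<noteq> 0" if "0 \<le> t" for t
    using cone_ray[OF \<open>hyperbolic a\<close> _ that] b cone_eq[OF a] by blast
  have "closed_segment a b \<subseteq> {x \<in> L. p x \<noteq> 0}"
  proof
    fix y assume "y \<in> closed_segment a b"
    then obtain u where u: "0 \<le> u" "u \<le> 1" "y = (1 - u) *\<^sub>R a + u *\<^sub>R b"
      by (auto simp: in_segment)
    have aL: "a \<in> L" "b \<in> L" "p a \<noteq> 0" using cone_nonzero[OF a] cone_nonzero[OF b] by auto
    show "y \<in> {x \<in> L. p x \<noteq> 0}"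
    proof (cases "u = 0")
      case False
      then have "y = u *\<^sub>R (b + ((1 - u) / u) *\<^sub>R a)"
        using False by (simp add: u(3) scaleR_add_right add.commute)
      moreover have "b + ((1 - u) / u) *\<^sub>R a \<in> L" using aL L by (simp add: subspace_add subspace_scale)
      ultimately show ?thesis
        using False u ray[of "(1 - u) / u"] L by (simp add: p_homogeneous subspace_scale)
    qed (use u aL in auto)
  qed
  then have "closed_segment a b \<subseteq> hcone a"
    by (intro connected_component_maximal) auto
  then show "closed_segment a b \<subseteq> hcone e" using cone_eq[OF a] by simp
qed

lemma cone_scale:
  assumes "x \<in> hcone e" "0 < c"
  shows "c *\<^sub>R x \<in> hcone e"
proof -
  have x: "x \<in> L" "p x \<noteq> 0" using cone_nonzero[OF assms(1)] by auto
  have "convex ((\<lambda>c. c *\<^sub>R x) ` {0<..})"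
    by (intro convex_linear_image) (auto intro: linearI simp: algebra_simps)
  then have "(\<lambda>c. c *\<^sub>R x) ` {0<..} \<subseteq> hcone x"
    using x L
    by (intro connected_component_maximal convex_connected)
      (auto simp: subspace_scale p_homogeneous intro!: image_eqI[of _ _ 1])
  then show ?thesis using assms cone_eq by blast
qed

lemma cone_pos:
  assumes "hyperbolic e" "0 < p e" "x \<in> hcone e"
  shows "0 < p x"
proof (rule ccontr)
  assume "\<not> 0 < p x"
  have "connected (p ` hcone e)"
    using continuous_on_subset[OF continuous_p] by (intro connected_continuous_image) auto
  then have "0 \<in> p ` hcone e"
    using connectedD_interval[of "p ` hcone e" "p x" "p e" 0] assms cone_contains_self \<open>\<not> 0 < p x\<close>
    by simp
  then obtain y where "y \<in> hcone e" "p y = 0" by auto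
  then show False using cone_nonzero by blast
qed

text \<open>The numbers \<open>r\<close> are the roots of \<open>w \<mapsto> p (D + w x)\<close>, which are real because \<open>x\<close> is
  hyperbolic; substituting \<open>w = 1 / t\<close> and clearing \<open>t ^ N\<close> turns \<open>w - r\<close> into
  \<open>1 - t r\<close>.\<close>
lemma line_factorization:
  assumes "hyperbolic x" "D \<in> L"
  obtains A :: "real multiset" where "\<And>t. p (x + t *\<^sub>R D) = p x * (\<Prod>r\<in>#A. 1 - t * r)"
proof -
  have x: "x \<in> L" "p x \<noteq> 0" using assms by (auto simp: hyperbolic_def)
  obtain q where q: "\<And>z \<zeta>. poly (q z) \<zeta> = f (z + cscale \<zeta> (x, 0))"
    "\<And>z. z \<in> L \<times> L \<Longrightarrow> degree (q z) = N"
    "\<And>z. z \<in> L \<times> L \<Longrightarrow> coeff (q z) N = of_real (p x)"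
    using line_polys[OF x] by metis
  define P where "P = q (D, 0)"
  have "(D, 0) \<in> L \<times> L" using assms L by (simp add: subspace_0)
  then have P: "degree P = N" "lead_coeff P = of_real (p x)" using q by (auto simp: P_def)
  then have "P \<noteq> 0" using x by auto
  then obtain A where A: "size A = N" "P = smult (of_real (p x)) (\<Prod>r\<in>#A. [:-r, 1:])"
    using alg_closed_imp_factorization[of P] P by auto
  have eval: "poly (\<Prod>r\<in>#B. [:-r, 1:]) w = (\<Prod>r\<in>#B. w - r)" for B and w :: complex
    by (induction B) (auto simp: algebra_simps)
  have P_eval: "poly P w = of_real (p x) * (\<Prod>r\<in>#A. w - r)" for w
    by (subst A(2)) (simp add: eval)
  have A_real: "r \<in> \<real>" if "r \<in># A" for r
  proof -
    have "poly P r = 0" using that by (auto simp: P_eval prod_mset_zero_iff)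
    then show ?thesis using assms by (auto simp: hyperbolic_def P_def q)
  qed
  define B where "B = image_mset Re A"
  have A_eq: "A = image_mset of_real B"
    unfolding B_def image_mset.compositionality
    using A_real by (intro multiset.map_ident_strong[symmetric]) (auto elim!: Reals_cases)
  have of_real_prod: "(\<Prod>r\<in>#B. complex_of_real s - of_real r) = of_real (\<Prod>r\<in>#B. s - r)" for s B
    by (induction B) auto
  have scale: "t ^ size B * (\<Prod>r\<in>#B. inverse t - r) = (\<Prod>r\<in>#B. 1 - t * r)" if "t \<noteq> 0" for t :: real and B
    using that by (induction B) (auto simp: field_simps)
  have "p (x + t *\<^sub>R D) = p x * (\<Prod>r\<in>#B. 1 - t * r)" for t
  proof (cases "t = 0")
    case False
    have inL: "D + inverse t *\<^sub>R x \<in> L" using assms x L by (simp add: subspace_add subspace_scale)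
    have "of_real (p (D + inverse t *\<^sub>R x)) = poly P (of_real (inverse t))"
      by (simp add: P_def q cscale_simps(3) f_real del: of_real_inverse)
    also have "\<dots> = of_real (p x * (\<Prod>r\<in>#B. inverse t - r))"
      by (simp add: P_eval A_eq image_mset.compositionality o_def of_real_prod del: of_real_inverse)
    finally have "p (D + inverse t *\<^sub>R x) = p x * (\<Prod>r\<in>#B. inverse t - r)"
      by (simp only: of_real_eq_iff)
    moreover have "x + t *\<^sub>R D = t *\<^sub>R (D + inverse t *\<^sub>R x)" using False by (simp add: algebra_simps)
    moreover have "size B = N" by (simp add: B_def A)
    ultimately show ?thesis using scale[OF False, of B] inL by (simp add: p_homogeneous mult_ac)
  qed simp
  then show ?thesis using that by blast
qed

text \<open>The whole line through \<open>x\<close> stays in the component, and its points, scaled down, converge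
  to \<open>D\<close>.\<close>
lemma constant_direction_in_closure:
  assumes "x \<in> hcone e" "D \<in> L" "\<And>t. p (x + t *\<^sub>R D) = p x"
  shows "D \<in> closure (hcone e)"
proof -
  have x: "x \<in> L" "p x \<noteq> 0" using cone_nonzero[OF assms(1)] by auto
  have "range (\<lambda>t. x + t *\<^sub>R D) \<subseteq> hcone x"
    using x L assms
    by (intro connected_component_maximal connected_continuous_image continuous_intros)
      (auto simp: subspace_add subspace_scale intro!: image_eqI[of _ _ 0])
  then have line: "x + t *\<^sub>R D \<in> hcone e" for t using cone_eq[OF assms(1)] by auto
  define s where "s n = inverse (real (Suc n)) *\<^sub>R (x + real (Suc n) *\<^sub>R D)" for n
  have "s n \<in> hcone e" for n unfolding s_def by (intro cone_scale line) auto
  moreover have "s = (\<lambda>n. inverse (real (Suc n)) *\<^sub>R x + D)"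
    by (simp add: s_def fun_eq_iff scaleR_add_right del: of_nat_Suc)
  then have "s \<longlonglongrightarrow> 0 *\<^sub>R x + D"
    using tendsto_add[OF tendsto_scaleR[OF LIMSEQ_inverse_real_of_nat tendsto_const] tendsto_const]
    by simp
  ultimately show ?thesis unfolding closure_sequential by auto
qed

text \<open>By \<open>line_factorization\<close> the logarithm of \<open>p\<close> along the segment is a sum of the concave
  functions \<open>ln (1 - t r)\<close>, strictly concave unless all \<open>r\<close> vanish. In that case \<open>p\<close> is
  constant along the line, which puts both directions \<open>y - x\<close> and \<open>x - y\<close> into the closed
  cone.\<close>
lemma ln_strictly_concave_off_edge:
  assumes "hyperbolic e" "0 < p e" "x \<in> hcone e" "y \<in> hcone e" "0 < t" "t < 1"
    and off_edge: "\<not> (y - x \<in> closure (hcone e) \<and> x - y \<in> closure (hcone e))"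
  shows "(1 - t) * ln (p x) + t * ln (p y) < ln (p ((1 - t) *\<^sub>R x + t *\<^sub>R y))"
proof -
  define D where "D = y - x"
  have xy: "x \<in> L" "y \<in> L" using cone_nonzero[OF assms(3)] cone_nonzero[OF assms(4)] by auto
  then have D: "D \<in> L" "x - y \<in> L" using L by (auto simp: D_def subspace_diff)
  have point: "(1 - s) *\<^sub>R x + s *\<^sub>R y = x + s *\<^sub>R D" for s by (simp add: D_def algebra_simps)
  have "hyperbolic x" using hyperbolic_cone assms by blast
  then obtain A where A: "\<And>t. p (x + t *\<^sub>R D) = p x * (\<Prod>r\<in>#A. 1 - t * r)"
    using line_factorization D(1) by blast
  have px: "0 < p x" using cone_pos assms by blast
  have in_cone: "x + s *\<^sub>R D \<in> hcone e" if "0 \<le> s" "s \<le> 1" for s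
    using convexD_alt[OF convex_cone[OF \<open>hyperbolic e\<close>] assms(3,4) that] by (simp add: point)
  \<comment> \<open>Otherwise \<open>p\<close> would vanish at the point of the segment with parameter \<open>1 / r\<close>.\<close>
  have r: "r < 1" if "r \<in># A" for r
  proof (rule ccontr)
    assume "\<not> r < 1"
    then have "p (x + (1 / r) *\<^sub>R D) \<noteq> 0"
      by (intro conjunct2[OF cone_nonzero[OF in_cone]]) auto
    moreover have "(\<Prod>s\<in>#A. 1 - (1 / r) * s) = 0"
      using that \<open>\<not> r < 1\<close> by (auto simp: prod_mset_zero_iff)
    ultimately show False by (simp add: A)
  qed
  have "\<exists>r\<in>#A. r \<noteq> 0"
  proof (rule ccontr)
    assume "\<not> (\<exists>r\<in>#A. r \<noteq> 0)"
    then have "image_mset (\<lambda>r. 1 - t * r) A = image_mset (\<lambda>r. 1) A" for t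
      by (intro image_mset_cong) auto
    then have const: "p (x + t *\<^sub>R D) = p x" for t by (simp add: A)
    have "D \<in> closure (hcone e)"
      using constant_direction_in_closure assms(3) D const by blast
    moreover have "x + t *\<^sub>R (x - y) = x + (- t) *\<^sub>R D" for t by (simp add: D_def algebra_simps)
    then have "x - y \<in> closure (hcone e)"
      using constant_direction_in_closure[OF assms(3) D(2)] const by presburger
    ultimately show False using off_edge by (simp add: D_def)
  qed
  then have "t * ln (\<Prod>r\<in>#A. 1 - r) < ln (\<Prod>r\<in>#A. 1 - t * r)"
    using ln_prod_affine_gt(3) r assms by blast
  moreover have "ln (p (x + s *\<^sub>R D)) = ln (p x) + ln (\<Prod>r\<in>#A. 1 - s * r)" if "0 < (\<Prod>r\<in>#A. 1 - s * r)" for s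
    using px that by (simp only: A ln_mult_pos)
  from this[of 1] this[of t] have "ln (p y) = ln (p x) + ln (\<Prod>r\<in>#A. 1 - r)"
    "ln (p (x + t *\<^sub>R D)) = ln (p x) + ln (\<Prod>r\<in>#A. 1 - t * r)"
    using ln_prod_affine_gt(1,2)[of A t] r assms by (auto simp: D_def)
  ultimately show ?thesis unfolding point by (simp add: algebra_simps)
qed


section \<open>The logarithmic barrier\<close>

lemma p_bound: obtains M where "0 < M" "\<And>x. x \<in> L \<Longrightarrow> \<bar>p x\<bar> \<le> M * norm x ^ N"
proof -
  have "compact (sphere 0 1 \<inter> L)" using closed_subspace[OF L] by (intro compact_Int_closed) auto
  then have "compact (p ` (sphere 0 1 \<inter> L))"
    using continuous_on_subset[OF continuous_p] by (intro compact_continuous_image) auto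
  then obtain M where M: "0 < M" "\<And>y. y \<in> p ` (sphere 0 1 \<inter> L) \<Longrightarrow> \<bar>y\<bar> \<le> M"
    using compact_imp_bounded bounded_pos by (metis real_norm_def)
  show ?thesis
  proof (rule that[of "max M \<bar>p 0\<bar>"])
    fix x assume x: "x \<in> L"
    show "\<bar>p x\<bar> \<le> max M \<bar>p 0\<bar> * norm x ^ N"
    proof (cases "x = 0")
      case True
      then show ?thesis using p_homogeneous[OF x, of 0] by (cases "N = 0") auto
    next
      case False
      define u where "u = inverse (norm x) *\<^sub>R x"
      have u: "u \<in> L" "norm u = 1" "x = norm x *\<^sub>R u"
        using False x L by (auto simp: u_def subspace_scale)
      then have "\<bar>p u\<bar> \<le> M" using M(2) by simp
      moreover have "\<bar>p x\<bar> = norm x ^ N * \<bar>p u\<bar>"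
        by (subst u(3)) (simp add: p_homogeneous[OF u(1)] abs_mult)
      moreover have "norm x ^ N * \<bar>p u\<bar> \<le> norm x ^ N * max M \<bar>p 0\<bar>"
        using \<open>\<bar>p u\<bar> \<le> M\<close> by (intro mult_left_mono) auto
      ultimately show ?thesis by (simp add: mult.commute)
    qed
  qed (use M in auto)
qed

text \<open>The linear term grows like \<open>\<epsilon> |x|\<close>, while \<open>ln (p x)\<close> is at most \<open>N ln |x|\<close> up to a
  constant.\<close>
lemma log_barrier_sublevel_bounded:
  assumes "hyperbolic e" "0 < p e" "0 < N" "0 < \<epsilon>"
    and B: "\<And>x. x \<in> X \<Longrightarrow> \<epsilon> * norm x \<le> B \<bullet> x" and X: "X \<subseteq> hcone e"
  shows "bounded {x \<in> X. B \<bullet> x - ln (p x) \<le> c}"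
proof -
  obtain M where M: "0 < M" "\<And>x. x \<in> L \<Longrightarrow> \<bar>p x\<bar> \<le> M * norm x ^ N" using p_bound by blast
  \<comment> \<open>With this \<open>\<delta>\<close> the tangent bound on \<open>ln (\<delta> |x|)\<close> uses up half of the linear growth.\<close>
  define \<delta> where "\<delta> = \<epsilon> / (2 * N)"
  have \<delta>: "0 < \<delta>" "N * \<delta> = \<epsilon> / 2" using assms by (auto simp: \<delta>_def)
  have "norm x \<le> 2 / \<epsilon> * (c + ln M - N * (1 + ln \<delta>))" if x: "x \<in> X" "B \<bullet> x - ln (p x) \<le> c" for x
  proof -
    have "x \<in> hcone e" using x X by auto
    then have xL: "x \<in> L" "0 < p x" using cone_nonzero cone_pos assms(1,2) by blast+
    have "x \<noteq> 0"
    proof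
      assume "x = 0"
      then show False using p_homogeneous[OF xL(1), of 0] xL(2) \<open>0 < N\<close> by (simp add: power_0_left)
    qed
    have "ln (p x) \<le> ln (M * norm x ^ N)" using M(2)[OF xL(1)] xL(2) by (intro ln_mono) auto
    also have "\<dots> = ln M + N * ln (norm x)"
      using M \<open>x \<noteq> 0\<close> by (simp add: ln_mult_pos ln_realpow)
    finally have 1: "ln (p x) \<le> ln M + N * ln (norm x)" .
    have "ln (\<delta> * norm x) \<le> \<delta> * norm x - 1" using \<delta> \<open>x \<noteq> 0\<close> by (intro ln_le_minus_one) auto
    then have "ln (norm x) \<le> \<delta> * norm x - 1 - ln \<delta>" using \<delta> \<open>x \<noteq> 0\<close> by (simp add: ln_mult_pos)
    then have "N * ln (norm x) \<le> N * (\<delta> * norm x - 1 - ln \<delta>)" by (intro mult_left_mono) auto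
    also have "\<dots> = (N * \<delta>) * norm x - N * (1 + ln \<delta>)" by (simp add: algebra_simps)
    also have "\<dots> = \<epsilon> / 2 * norm x - N * (1 + ln \<delta>)" by (simp only: \<delta>(2))
    finally have "\<epsilon> / 2 * norm x \<le> c + ln M - N * (1 + ln \<delta>)"
      using 1 B[OF x(1)] x(2) by (simp add: algebra_simps)
    then show ?thesis using \<open>0 < \<epsilon>\<close> by (simp add: field_simps)
  qed
  then show ?thesis by (auto simp: bounded_iff)
qed

text \<open>On a sublevel set \<open>p\<close> is bounded below by a positive constant \<open>\<mu>\<close>. A limit point
  therefore satisfies \<open>p > 0\<close>, and as it lies in the closure of the component it belongs to
  the component.\<close>
lemma log_barrier_sublevel_compact:
  assumes "hyperbolic e" "0 < p e" "0 < N" "0 < \<epsilon>" "closed S"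
    and B: "\<And>x. x \<in> hcone e \<inter> S \<Longrightarrow> \<epsilon> * norm x \<le> B \<bullet> x"
  shows "compact {x \<in> hcone e \<inter> S. B \<bullet> x - ln (p x) \<le> c}" (is "compact ?K")
proof -
  have bounded: "bounded ?K"
    using log_barrier_sublevel_bounded[OF assms(1-4), of "hcone e \<inter> S" B c] B by auto
  then obtain R where R: "\<And>x. x \<in> ?K \<Longrightarrow> norm x \<le> R" unfolding bounded_iff by blast
  define \<mu> where "\<mu> = exp (- norm B * R - c)"
  have lower: "\<mu> \<le> p x" if "x \<in> ?K" for x
  proof -
    have "- (norm B * norm x) \<le> B \<bullet> x" using Cauchy_Schwarz_ineq2[of B x] by linarith
    moreover have "norm B * norm x \<le> norm B * R" using R[OF that] by (intro mult_left_mono) auto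
    ultimately have "- norm B * R - c \<le> ln (p x)" using that by auto
    moreover have "0 < p x" using that cone_pos assms by blast
    ultimately show ?thesis unfolding \<mu>_def by (metis exp_le_cancel_iff exp_ln)
  qed
  have "closed ?K"
    unfolding closed_sequential_limits
  proof (intro allI impI)
    fix x l assume "(\<forall>n. x n \<in> ?K) \<and> x \<longlonglongrightarrow> l"
    then have x: "\<And>n. x n \<in> ?K" and lim: "x \<longlonglongrightarrow> l" by auto
    have xc: "x n \<in> hcone e" "x n \<in> S" for n using x by auto
    have "l \<in> S" using \<open>closed S\<close> xc lim unfolding closed_sequential_limits by blast
    have "l \<in> L"
      using closed_subspace[OF L] cone_nonzero[OF xc(1)] lim unfolding closed_sequential_limits by blast
    have p_lim: "(\<lambda>n. p (x n)) \<longlonglongrightarrow> p l"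
      by (rule continuous_on_tendsto_compose[OF continuous_p lim]) auto
    have "\<mu> \<le> p l" by (rule LIMSEQ_le_const[OF p_lim]) (use lower x in blast)
    moreover have "0 < \<mu>" by (simp add: \<mu>_def)
    ultimately have pl: "0 < p l" by linarith
    have "l \<in> closure (hcone e)" using xc(1) lim unfolding closure_sequential by blast
    have "connected (insert l (hcone e))"
    proof (rule connected_intermediate_closure)
      show "connected (hcone e)" by (rule connected_connected_component)
      show "insert l (hcone e) \<subseteq> closure (hcone e)"
        using closure_subset[of "hcone e"] \<open>l \<in> closure (hcone e)\<close> by blast
    qed blast
    moreover have "e \<in> insert l (hcone e)" using cone_contains_self[OF \<open>hyperbolic e\<close>] by blast
    moreover have "insert l (hcone e) \<subseteq> {x \<in> L. p x \<noteq> 0}"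
      using connected_component_subset[of "{x \<in> L. p x \<noteq> 0}" e] \<open>l \<in> L\<close> pl by simp
    ultimately have "insert l (hcone e) \<subseteq> hcone e"
      by (intro connected_component_maximal)
    then have "l \<in> hcone e" by blast
    have "(\<lambda>n. B \<bullet> x n - ln (p (x n))) \<longlonglongrightarrow> B \<bullet> l - ln (p l)"
      using pl by (intro tendsto_intros lim p_lim) auto
    then have "B \<bullet> l - ln (p l) \<le> c" by (rule LIMSEQ_le_const2) (use x in auto)
    then show "l \<in> ?K" using \<open>l \<in> S\<close> \<open>l \<in> hcone e\<close> by blast
  qed
  then show ?thesis using bounded by (simp add: compact_eq_bounded_closed)
qed

text \<open>The hypothesis on \<open>S\<close> says that \<open>S\<close> meets the edge of the cone only in \<open>0\<close>, so
  every segment in \<open>S\<close> runs off the edge.\<close>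
lemma log_barrier_strictly_convex:
  assumes "hyperbolic e" "0 < p e" "subspace S"
    and edge: "\<And>D. D \<in> S \<Longrightarrow> D \<in> closure (hcone e) \<Longrightarrow> - D \<in> closure (hcone e) \<Longrightarrow> D = 0"
  shows "strictly_convex_on (hcone e \<inter> S) (\<lambda>x. B \<bullet> x - ln (p x))"
  unfolding strictly_convex_on_def
proof (intro conjI ballI allI impI)
  show "convex (hcone e \<inter> S)"
    using convex_cone[OF \<open>hyperbolic e\<close>] subspace_imp_convex[OF \<open>subspace S\<close>] by (rule convex_Int)
  fix x y t assume x: "x \<in> hcone e \<inter> S" and y: "y \<in> hcone e \<inter> S" and t: "x \<noteq> y \<and> 0 < t \<and> t < (1::real)"
  have "y - x \<in> S" using x y \<open>subspace S\<close> by (simp add: subspace_diff)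
  then have "\<not> (y - x \<in> closure (hcone e) \<and> x - y \<in> closure (hcone e))"
    using edge[of "y - x"] t by auto
  then have "(1 - t) * ln (p x) + t * ln (p y) < ln (p ((1 - t) *\<^sub>R x + t *\<^sub>R y))"
    using ln_strictly_concave_off_edge[OF assms(1,2)] x y t by blast
  then show "B \<bullet> ((1 - t) *\<^sub>R x + t *\<^sub>R y) - ln (p ((1 - t) *\<^sub>R x + t *\<^sub>R y))
      < (1 - t) * (B \<bullet> x - ln (p x)) + t * (B \<bullet> y - ln (p y))"
    by (simp add: inner_add_right algebra_simps)
qed

end

section \<open>Smoothness\<close>

lemma real_polynomial_function_derivative:
  assumes "real_polynomial_function p"
  obtains p' where "\<And>x. (p has_derivative p' x) (at x)" "\<And>v. real_polynomial_function (\<lambda>x. p' x v)"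
proof -
  have "\<exists>p'. (\<forall>x. (p has_derivative p' x) (at x)) \<and> (\<forall>v. real_polynomial_function (\<lambda>x. p' x v))"
    using assms
  proof induction
    case (linear l)
    then show ?case
      by (intro exI[of _ "\<lambda>_. l"]) (auto intro: bounded_linear_imp_has_derivative)
  next
    case (const c)
    then show ?case by (intro exI[of _ "\<lambda>_ _. 0"]) auto
  next
    case (add p q)
    then obtain p' q' where "\<And>x. (p has_derivative p' x) (at x)" "\<And>v. real_polynomial_function (\<lambda>x. p' x v)"
      "\<And>x. (q has_derivative q' x) (at x)" "\<And>v. real_polynomial_function (\<lambda>x. q' x v)" by blast
    then show ?case
      by (intro exI[of _ "\<lambda>x v. p' x v + q' x v"]) (auto intro: has_derivative_add)
  next
    case (mult p q)
    then obtain p' q' where "\<And>x. (p has_derivative p' x) (at x)" "\<And>v. real_polynomial_function (\<lambda>x. p' x v)"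
      "\<And>x. (q has_derivative q' x) (at x)" "\<And>v. real_polynomial_function (\<lambda>x. q' x v)" by blast
    then show ?case
      using mult.hyps
      by (intro exI[of _ "\<lambda>x v. p x * q' x v + p' x v * q x"] conjI allI has_derivative_mult
          real_polynomial_function.intros(3,4))
  qed
  then show ?thesis using that by blast
qed

text \<open>These functions are closed under directional derivatives, so induction on \<open>k\<close> works; the
  constant \<open>c\<close> accommodates the contribution of the linear term of the barrier.\<close>
lemma Ck_on_polynomial_quotient:
  assumes q: "real_polynomial_function q" and "\<And>x. x \<in> U \<Longrightarrow> q x \<noteq> 0"
    and "real_polynomial_function r"
  shows "Ck_on k V U (\<lambda>x. c + r x * inverse (q x) ^ m)"
  using assms(3)
proof (induction k arbitrary: c r m)
  case 0
  have "continuous_on U q" "continuous_on U r"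
    using q 0 by (auto intro: continuous_on_polymonial_function simp: real_polynomial_function_eq)
  then show ?case using assms(2) by (auto intro!: continuous_intros)
next
  case (Suc k)
  obtain q' where q': "\<And>x. (q has_derivative q' x) (at x)" "\<And>v. real_polynomial_function (\<lambda>x. q' x v)"
    using real_polynomial_function_derivative[OF q] by blast
  obtain r' where r': "\<And>x. (r has_derivative r' x) (at x)" "\<And>v. real_polynomial_function (\<lambda>x. r' x v)"
    using real_polynomial_function_derivative[OF Suc.prems] by blast
  define F where "F x v = 0 + (r' x v * q x - real m * (r x * q' x v)) * inverse (q x) ^ Suc m" for x v
  have "((\<lambda>x. c + r x * inverse (q x) ^ m) has_derivative F x) (at x within V)" if "x \<in> U" for x
  proof -
    have "q x \<noteq> 0" using assms(2) that .
    have "((\<lambda>x. c + r x * inverse (q x) ^ m) has_derivative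
       (\<lambda>v. 0 + (r x * (real m * (- (inverse (q x) * q' x v * inverse (q x))) * inverse (q x) ^ (m - 1))
          + r' x v * inverse (q x) ^ m))) (at x)"
      by (intro has_derivative_add has_derivative_const has_derivative_mult has_derivative_power
          Deriv.has_derivative_inverse q' r' \<open>q x \<noteq> 0\<close>)
    also have "(\<lambda>v. 0 + (r x * (real m * (- (inverse (q x) * q' x v * inverse (q x))) * inverse (q x) ^ (m - 1))
          + r' x v * inverse (q x) ^ m)) = F x"
      using \<open>q x \<noteq> 0\<close> by (cases m) (auto simp: F_def fun_eq_iff field_simps)
    finally show ?thesis by (rule has_derivative_at_withinI)
  qed
  moreover have "Ck_on k V U (\<lambda>x. F x v)" for v
    unfolding F_def
    by (rule Suc.IH) (intro real_polynomial_function_diff real_polynomial_function.intros(2,4)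
        q q' r' Suc.prems)
  ultimately show ?case by auto
qed

lemma C_infinity_on_linear_minus_ln:
  assumes p: "real_polynomial_function p" and l: "bounded_linear l" and "U \<subseteq> V"
    and pos: "\<And>x. x \<in> U \<Longrightarrow> 0 < p x"
    and f: "\<And>x. x \<in> V \<Longrightarrow> f x = l x - ln (p x)"
  shows "C_infinity_on V U f"
  unfolding C_infinity_on_def
proof
  obtain p' where p': "\<And>x. (p has_derivative p' x) (at x)" "\<And>v. real_polynomial_function (\<lambda>x. p' x v)"
    using real_polynomial_function_derivative[OF p] by blast
  define F where "F x v = l v + (- p' x v) * inverse (p x) ^ 1" for x v
  have deriv: "(f has_derivative F x) (at x within V)" if "x \<in> U" for x
  proof -
    have "((\<lambda>x. l x - ln (p x)) has_derivative (\<lambda>v. l v - inverse (p x) * p' x v)) (at x)"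
      using pos[OF that]
      by (intro has_derivative_diff bounded_linear_imp_has_derivative l has_derivative_compose[OF p'(1), of ln])
        (auto simp: has_field_derivative_def[symmetric] intro!: DERIV_ln)
    moreover have "(\<lambda>v. l v - inverse (p x) * p' x v) = F x" by (auto simp: F_def fun_eq_iff)
    ultimately have "((\<lambda>x. l x - ln (p x)) has_derivative F x) (at x within V)"
      by (metis has_derivative_at_withinI)
    then show ?thesis using that \<open>U \<subseteq> V\<close> f
      by (intro has_derivative_transform[of x V f "\<lambda>x. l x - ln (p x)"]) blast+
  qed
  fix k
  show "Ck_on k V U f"
  proof (cases k)
    case 0
    have "continuous (at x within U) f" if "x \<in> U" for x
      using has_derivative_continuous[OF deriv[OF that]] \<open>U \<subseteq> V\<close> continuous_within_subset by blast
    then show ?thesis by (simp add: 0 continuous_on_eq_continuous_within)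
  next
    case (Suc j)
    have "Ck_on j V U (\<lambda>x. F x v)" for v
      unfolding F_def
      by (intro Ck_on_polynomial_quotient p p' real_polynomial_function_minus) (use pos in force)
    then show ?thesis using deriv Suc by auto
  qed
qed

section \<open>Symmetric matrices\<close>

lemma trace_inner_eq_inner:
  assumes "A \<in> sym_mats"
  shows "trace_inner A B = A \<bullet> B"
proof -
  have "transpose A = A" using assms by (simp add: sym_mats_def)
  then have sym: "A $ i $ j = A $ j $ i" for i j
    using transpose_def[of A] by (metis vec_lambda_beta)
  have "trace_inner A B = (\<Sum>i\<in>UNIV. \<Sum>j\<in>UNIV. A $ i $ j * B $ j $ i)"
    by (simp add: trace_inner_def trace_def matrix_matrix_mult_def)
  also have "\<dots> = (\<Sum>j\<in>UNIV. \<Sum>i\<in>UNIV. A $ j $ i * B $ j $ i)"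
    by (subst sum.swap) (simp add: sym)
  finally show ?thesis by (simp add: inner_vec_def)
qed

lemma subspace_sym_mats: "subspace sym_mats"
  unfolding sym_mats_def by (rule subspaceI) (auto simp: transpose_def vec_eq_iff)

lemma garding_span_altdef:
  "garding_span g = sym_mats \<inter> (\<Inter>A\<in>garding_edge g. {B. B \<bullet> A = 0})"
  by (auto simp: garding_span_def trace_inner_eq_inner)

lemma subspace_garding_span: "subspace (garding_span g)"
  unfolding garding_span_altdef
  by (intro subspace_Int subspace_inter subspace_sym_mats) (auto simp: subspace_def inner_add_left)

lemma garding_span_Int_edge: "D \<in> garding_span g \<Longrightarrow> D \<in> garding_edge g \<Longrightarrow> D = 0"
  by (auto simp: garding_span_altdef)

text \<open>As \<open>B\<close> is interior to the polar relative to the span, \<open>B\<close> minus a small multiple of the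
  unit vector \<open>A / |A|\<close> is still in the polar; pairing it with \<open>A\<close> gives the bound.\<close>
lemma open_polar_coercive:
  assumes "B \<in> garding_open_polar g"
  obtains \<epsilon> where "0 < \<epsilon>" "\<And>A. A \<in> garding_cone g \<inter> garding_span g \<Longrightarrow> \<epsilon> * norm A \<le> B \<bullet> A"
proof -
  obtain T where T: "openin (top_of_set (garding_span g)) T" "T \<subseteq> garding_polar g" "B \<in> T"
    using assms unfolding garding_open_polar_def interior_of_def by blast
  then obtain d where d: "0 < d" "ball B d \<inter> garding_span g \<subseteq> T" and B: "B \<in> garding_span g"
    unfolding openin_contains_ball by blast
  have "d / 2 * norm A \<le> B \<bullet> A" if A: "A \<in> garding_cone g \<inter> garding_span g" for A
  proof (cases "A = 0")
    case False
    define C where "C = B - (d / 2 / norm A) *\<^sub>R A"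
    have "C \<in> garding_span g"
      using A B subspace_garding_span by (auto simp: C_def intro: subspace_diff subspace_scale)
    moreover have "C \<in> ball B d" using d(1) False by (simp add: C_def dist_norm)
    ultimately have "C \<in> garding_polar g" using d T by blast
    then have "0 \<le> C \<bullet> A" using A by (auto simp: garding_polar_def trace_inner_eq_inner)
    then show ?thesis
      using False by (simp add: C_def inner_diff_left dot_square_norm power2_eq_square)
  qed simp
  then show ?thesis using that[of "d / 2"] d by simp
qed

theorem theorem8p1:
  fixes g :: "real^'n^'n \<Rightarrow> real" and N :: nat and B :: "real^'n^'n"
    and \<psi> :: "real^'n^'n \<Rightarrow> real"
  assumes "N \<ge> 1"
    and "garding_dirichlet N g"
    and "B \<in> garding_open_polar g"
  defines "\<psi> \<equiv> \<lambda>A. trace_inner B A - ln (g A)"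
  shows "exhaustion_function_on (garding_cone g \<inter> garding_span g) \<psi> \<and>
    C_infinity_on (garding_span g) (garding_cone g \<inter> garding_span g) \<psi> \<and>
    strictly_convex_on (garding_cone g \<inter> garding_span g) \<psi>"
proof -
  obtain p where p: "real_polynomial_function p" and gp: "\<And>A. A \<in> sym_mats \<Longrightarrow> g A = p A"
    and hom: "\<And>A t. A \<in> sym_mats \<Longrightarrow> g (t *\<^sub>R A) = t ^ N * g A"
    using assms(2) by (auto simp: garding_dirichlet_def homogeneous_polynomial_on_sym_def)
  obtain f where f: "complexification p f" using ex_complexification[OF p] by blast
  have scale: "t *\<^sub>R A \<in> sym_mats" if "A \<in> sym_mats" for t and A :: "real^'n^'n"
    using that subspace_sym_mats by (rule subspace_scale[rotated])
  interpret complexified_form sym_mats p f N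
    using f hom by unfold_locales (simp_all add: subspace_sym_mats gp[symmetric] scale)
  have I: "(mat 1 :: real^'n^'n) \<in> sym_mats" by (simp add: sym_mats_def)
  have pI: "0 < p (mat 1)" using assms(2) I by (simp add: garding_dirichlet_def gp)
  have hyp: "hyperbolic (mat 1)"
  proof (rule hyperbolicI[OF I])
    fix x :: "real^'n^'n" assume x: "x \<in> sym_mats"
    then have "t *\<^sub>R mat 1 + x \<in> sym_mats" for t
      using I scale subspace_add[OF subspace_sym_mats] by blast
    then show "\<exists>q. (\<forall>t. poly q t = p (t *\<^sub>R mat 1 + x)) \<and>
        (\<forall>z :: complex. poly (map_poly of_real q) z = 0 \<longrightarrow> z \<in> \<real>)"
      using assms(2) x gp unfolding garding_dirichlet_def by metis
  qed (use pI in simp)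
  let ?\<Gamma> = "garding_cone g" and ?S = "garding_span g"
  have cone: "?\<Gamma> = hcone (mat 1)"
    unfolding garding_cone_def by (rule arg_cong[where f = "\<lambda>X. connected_component_set X (mat 1)"]) (auto simp: gp)
  have S_sym: "?S \<subseteq> sym_mats" by (auto simp: garding_span_def)
  have "B \<in> sym_mats"
    using assms(3) interior_of_subset by (fastforce simp: garding_open_polar_def garding_polar_def)
  then have \<psi>: "\<psi> A = B \<bullet> A - ln (p A)" if "A \<in> ?S" for A
    using that S_sym by (auto simp: \<psi>_def trace_inner_eq_inner gp)
  obtain \<epsilon> where \<epsilon>: "0 < \<epsilon>" "\<And>A. A \<in> ?\<Gamma> \<inter> ?S \<Longrightarrow> \<epsilon> * norm A \<le> B \<bullet> A"
    using open_polar_coercive[OF assms(3)] by blast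
  have "compact {x \<in> ?\<Gamma> \<inter> ?S. \<psi> x \<le> c}" for c
  proof -
    have "compact {x \<in> ?\<Gamma> \<inter> ?S. B \<bullet> x - ln (p x) \<le> c}"
      using assms(1) \<epsilon> closed_subspace[OF subspace_garding_span]
      unfolding cone by (intro log_barrier_sublevel_compact[OF hyp pI]) auto
    also have "{x \<in> ?\<Gamma> \<inter> ?S. B \<bullet> x - ln (p x) \<le> c} = {x \<in> ?\<Gamma> \<inter> ?S. \<psi> x \<le> c}" by (auto simp: \<psi>)
    finally show ?thesis .
  qed
  then have "exhaustion_function_on (?\<Gamma> \<inter> ?S) \<psi>"
    unfolding exhaustion_function_on_def by fast
  moreover have "C_infinity_on ?S (?\<Gamma> \<inter> ?S) \<psi>"
    by (rule C_infinity_on_linear_minus_ln[OF p bounded_linear_inner_right])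
      (use cone_pos[OF hyp pI] \<psi> in \<open>auto simp: cone\<close>)
  moreover have "strictly_convex_on (?\<Gamma> \<inter> ?S) \<psi>"
  proof -
    have "strictly_convex_on (?\<Gamma> \<inter> ?S) (\<lambda>x. B \<bullet> x - ln (p x))"
      unfolding cone
    proof (rule log_barrier_strictly_convex[OF hyp pI subspace_garding_span])
      fix D assume "D \<in> ?S" "D \<in> closure (hcone (mat 1))" "- D \<in> closure (hcone (mat 1))"
      then show "D = 0"
        by (intro garding_span_Int_edge[of D g]) (auto simp: garding_edge_def cone intro!: image_eqI[of _ _ "- D"])
    qed
    moreover have "(1 - t) *\<^sub>R x + t *\<^sub>R y \<in> ?S" if "x \<in> ?S" "y \<in> ?S" for x y t
      using that subspace_garding_span by (intro subspace_add subspace_scale) auto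
    ultimately show ?thesis by (simp add: strictly_convex_on_def \<psi>)
  qed
  ultimately show ?thesis by blast
qed

end
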